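(* Let $p\in(0,1]$ and $\psi\in L^p(\mathbb{R}^d)$. Then $S:\ell^p(\mathbb{Z}_+\times\mathbb{Z}^d)\to L^p(\mathbb{R}^d)$ is continuous and linear. More precisely, if $c=\{c_{j,k}\}\in\ell^p(\mathbb{Z}_+\times\mathbb{Z}^d)$, then the series $$Sc=\sum_{j>0}\sum_{k\in\mathbb{Z}^d}c_{j,k}\psi_{j,k}$$ converges pointwise absolutely a.e. to a function in $L^p(\mathbb{R}^d)$ (and hence $Sc$ converges unconditionally in $L^p(\mathbb{R}^d)$), and $$\|Sc\|_p\le\|\psi\|_p\,\|c\|_{\ell^p(\mathbb{Z}_+\times\mathbb{Z}^d)}.$$
   Context: Fix a dimension $d\in\mathbb{N}$. Functions and sequences are complex valued. $\mathbb{Z}_+=\{j\in\mathbb{Z}:j>0\}$. Fix invertible real $d\times d$ matrices $a_j$ ($j\in\mathbb{Z}_+$) with $\|a_j^{-1}\|\to0$ as $j\to\infty$ (operator norm), and an invertible real $d\times d$ matrix $b$. For $\psi\in L^p(\mathbb{R}^d)$ put $\psi_{j,k}(x)=|\det a_j|^{1/p}\psi(a_jx-bk)$, $x\in\mathbb{R}^d$, $j>0$, $k\in\mathbb{Z}^d$. $\|f\|_p=(\int_{\mathbb{R}^d}|f|^p\,dx)^{1/p}$, and $L^p(\mathbb{R}^d)$ carries the metric $d_p(f,g)=\|f-g\|_p^p$. $\ell^p(\mathbb{Z}_+\times\mathbb{Z}^d)$ is the space of sequences $c=\{c_{j,k}\}_{j>0,k\in\mathbb{Z}^d}$ with $\|c\|_{\ell^p(\mathbb{Z}_+\times\mathbb{Z}^d)}=(\sum_{j>0}\sum_{k\in\mathbb{Z}^d}|c_{j,k}|^p)^{1/p}<\infty$,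 with metric $d_{\ell^p}(c,\tilde c)=\|c-\tilde c\|_{\ell^p(\mathbb{Z}_+\times\mathbb{Z}^d)}^p$. *)

theory Defs
  imports "HOL-Analysis.Analysis"
begin

text \<open>
  Elements of \<open>L\<^sup>p\<close> are represented by functions, so equality in \<open>L\<^sup>p\<close> is equality almost everywhere.
  Note that \<open>0 powr p = 0\<close>.
\<close>

definition Lp_space :: "real \<Rightarrow> (real ^ 'n \<Rightarrow> complex) set" where
  "Lp_space p = {f. f \<in> borel_measurable lebesgue \<and> integrable lebesgue (\<lambda>x. norm (f x) powr p)}"

definition Lp_norm :: "real \<Rightarrow> (real ^ 'n \<Rightarrow> complex) \<Rightarrow> real" where
  "Lp_norm p f = (LINT x|lebesgue. norm (f x) powr p) powr (1 / p)"

definition Lp_dist :: "real \<Rightarrow> (real ^ 'n \<Rightarrow> complex) \<Rightarrow> (real ^ 'n \<Rightarrow> complex) \<Rightarrow> real" where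
  "Lp_dist p f g = Lp_norm p (\<lambda>x. f x - g x) powr p"

definition index_set :: "(int \<times> (int ^ 'n)) set" where
  "index_set = {0<..} \<times> UNIV"

text \<open>A sequence is a function on all pairs; its values off the index set play no role anywhere.\<close>

definition lp_space :: "real \<Rightarrow> (int \<times> (int ^ 'n) \<Rightarrow> complex) set" where
  "lp_space p = {c. (\<lambda>i. norm (c i) powr p) summable_on index_set}"

definition lp_norm :: "real \<Rightarrow> (int \<times> (int ^ 'n) \<Rightarrow> complex) \<Rightarrow> real" where
  "lp_norm p c = (\<Sum>\<^sub>\<infinity>i\<in>index_set. norm (c i) powr p) powr (1 / p)"

definition lp_dist ::
  "real \<Rightarrow> (int \<times> (int ^ 'n) \<Rightarrow> complex) \<Rightarrow> (int \<times> (int ^ 'n) \<Rightarrow> complex) \<Rightarrow> real" where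
  "lp_dist p c c' = lp_norm p (\<lambda>i. c i - c' i) powr p"

definition dilate_translate ::
  "real \<Rightarrow> (int \<Rightarrow> real ^ 'n ^ 'n) \<Rightarrow> real ^ 'n ^ 'n \<Rightarrow> (real ^ 'n \<Rightarrow> complex)
    \<Rightarrow> int \<times> (int ^ 'n) \<Rightarrow> real ^ 'n \<Rightarrow> complex" where
  "dilate_translate p a b \<psi> = (\<lambda>(j, k) x.
     of_real (\<bar>det (a j)\<bar> powr (1 / p)) * \<psi> (a j *v x - b *v (\<chi> i. of_int (k $ i))))"

text \<open>
  \<open>infsum\<close> is the sum of the absolutely convergent double series, and \<open>0\<close> at the points \<open>x\<close>
  where the series does not converge absolutely.
\<close>

definition synthesis ::
  "real \<Rightarrow> (int \<Rightarrow> real ^ 'n ^ 'n) \<Rightarrow> real ^ 'n ^ 'n \<Rightarrow> (real ^ 'n \<Rightarrow> complex)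
    \<Rightarrow> (int \<times> (int ^ 'n) \<Rightarrow> complex) \<Rightarrow> real ^ 'n \<Rightarrow> complex" where
  "synthesis p a b \<psi> c = (\<lambda>x. \<Sum>\<^sub>\<infinity>i\<in>index_set. c i * dilate_translate p a b \<psi> i x)"

text \<open>
  Unconditional convergence in \<open>L\<^sup>p\<close>: the analogue of \<open>has_sum\<close> with respect to the metric of \<open>L\<^sup>p\<close>.
  By \<open>Lp_has_sum_rearrangement\<close>, every rearrangement then converges to the same limit.
\<close>

definition Lp_has_sum ::
  "real \<Rightarrow> ('i \<Rightarrow> real ^ 'n \<Rightarrow> complex) \<Rightarrow> 'i set \<Rightarrow> (real ^ 'n \<Rightarrow> complex) \<Rightarrow> bool" where
  "Lp_has_sum p u I f \<longleftrightarrow>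
     (\<forall>i\<in>I. u i \<in> Lp_space p) \<and> f \<in> Lp_space p \<and>
     ((\<lambda>F. Lp_dist p (\<lambda>x. \<Sum>i\<in>F. u i x) f) \<longlongrightarrow> 0) (finite_subsets_at_top I)"

lemma Lp_has_sum_rearrangement:
  assumes "Lp_has_sum p u I f" and e: "bij_betw e (UNIV :: nat set) I"
  shows "(\<lambda>n. Lp_dist p (\<lambda>x. \<Sum>m<n. u (e m) x) f) \<longlonglongrightarrow> 0"
proof -
  have inj: "inj_on e A" for A
    using e by (meson bij_betw_def inj_on_subset subset_UNIV)
  have lim: "((\<lambda>F. Lp_dist p (\<lambda>x. \<Sum>i\<in>F. u i x) f) \<longlongrightarrow> 0) (finite_subsets_at_top I)"
    using assms(1) by (simp add: Lp_has_sum_def)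
  have "filterlim (\<lambda>n. e ` {..<n}) (finite_subsets_at_top I) sequentially"
    unfolding filterlim_finite_subsets_at_top
  proof (intro allI impI)
    fix X assume X: "finite X \<and> X \<subseteq> I"
    then obtain Y where Y: "finite Y" "X = e ` Y"
      using e by (metis bij_betw_imp_surj_on finite_subset_image)
    then obtain N where N: "Y \<subseteq> {..<N}"
      using finite_nat_bounded by blast
    show "\<forall>\<^sub>F n in sequentially. finite (e ` {..<n}) \<and> X \<subseteq> e ` {..<n} \<and> e ` {..<n} \<subseteq> I"
      using eventually_ge_at_top[of N]
    proof eventually_elim
      case (elim n)
      then have "Y \<subseteq> {..<n}" using N by auto
      then show ?case using Y e by (auto simp: bij_betw_def)
    qed
  qed
  from filterlim_compose[OF lim this]
  have "(\<lambda>n. Lp_dist p (\<lambda>x. \<Sum>i\<in>e ` {..<n}. u i x) f) \<longlonglongrightarrow> 0"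
    .
  then show ?thesis
    by (simp add: sum.reindex[OF inj])
qed

end

theory Submission
  imports Defs
begin

text \<open>
  For \<open>p \<le> 1\<close> the map \<open>t \<mapsto> t powr p\<close> is subadditive, so at every point
  \<open>(\<Sum>i. \<bar>c i\<bar> \<bar>\<psi> i\<bar>) powr p \<le> \<Sum>i. \<bar>c i\<bar> powr p * \<bar>\<psi> i\<bar> powr p\<close>.
  All \<open>\<psi> i\<close> have the same \<open>L\<^sup>p\<close> norm as \<open>\<psi>\<close>, by an affine change of variables. Integrating with
  Tonelli's theorem gives absolute convergence almost everywhere and the norm bound at once;
  unconditional convergence is the same bound applied to the tails of the series.
\<close>

subsection \<open>Affine change of variables\<close>

text \<open>
  The change-of-variables theorems of the library require a well-ordered index type, hence the
  direct proof for an arbitrary finite one, by factoring the matrix into elementary matrices.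
\<close>

lemma lborel_distr_linear_bij:
  fixes f g :: "'a::euclidean_space \<Rightarrow> 'a"
  assumes lin: "linear f" "linear g"
    and inv: "\<And>x. g (f x) = x" "\<And>x. f (g x) = x"
    and cbox: "\<And>l u. measure lebesgue (f ` cbox l u) = measure lebesgue (cbox l u)"
  shows "lborel = distr lborel borel f"
proof -
  have [measurable]: "f \<in> borel_measurable borel" "g \<in> borel_measurable borel"
    using lin by (auto intro!: borel_measurable_continuous_onI linear_continuous_on
        simp: linear_conv_bounded_linear)
  \<comment> \<open>The inverse \<open>g\<close> comes first because the preimage of a box under
    \<open>g\<close> is its image under \<open>f\<close>, and the hypothesis speaks of images under
    \<open>f\<close>. Pushing the result forward by \<open>f\<close> gives the claim, as
    \<open>f \<circ> g = id\<close>.\<close>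
  have "lborel = distr lborel borel g"
  proof (rule lborel_eqI)
    fix l u :: 'a assume le: "\<And>b. b \<in> Basis \<Longrightarrow> l \<bullet> b \<le> u \<bullet> b"
    have vim: "g -` box l u = f ` box l u"
      using inv by (auto simp: image_iff) metis
    \<comment> \<open>The volume of images of closed boxes determines that of images of all
      measurable sets under a linear map; the scaling factor here is 1.\<close>
    have im: "f ` box l u \<in> lmeasurable" "measure lebesgue (f ` box l u) = measure lebesgue (box l u)"
      using measure_linear_sufficient[of f "box l u" 1] lin(1) cbox by auto
    have "g -` box l u \<in> sets borel"
      using measurable_sets[of g borel borel "box l u"] by simp
    then have "emeasure (distr lborel borel g) (box l u) = emeasure lebesgue (f ` box l u)"
      by (simp add: emeasure_distr vim)
    also have "\<dots> = ennreal (measure lebesgue (box l u))"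
      using emeasure_eq_measure2[OF im(1)] im(2) by simp
    also have "\<dots> = emeasure lborel (box l u)"
      using emeasure_lborel_box_finite[of l u] by (subst emeasure_eq_ennreal_measure[symmetric]) auto
    also have "\<dots> = (\<Prod>b\<in>Basis. (u - l) \<bullet> b)"
      using le by (simp add: emeasure_lborel_box)
    finally show "emeasure (distr lborel borel g) (box l u) = (\<Prod>b\<in>Basis. (u - l) \<bullet> b)" .
  qed simp
  then have "distr lborel borel f = distr (distr lborel borel g) borel f"
    by simp
  also have "\<dots> = distr lborel borel (f \<circ> g)"
    by (rule distr_distr) simp_all
  also have "f \<circ> g = id"
    using inv by (simp add: fun_eq_iff)
  also have "distr lborel borel id = (lborel :: 'a measure)"
    by (simp add: id_def distr_id2)
  finally show ?thesis by simp
qed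

text \<open>Swapping two coordinates is an involution that sends a box to the box with two sides
  exchanged, and the volume is a product over the sides in any order.\<close>

lemma lborel_distr_transpose:
  "lborel = distr lborel borel (\<lambda>x::real^'n. \<chi> i. x $ Transposition.transpose m n i)"
    (is "_ = distr _ _ ?h")
proof (rule lborel_distr_linear_bij[where g = ?h])
  show "linear ?h" "linear ?h"
    by (rule linearI; simp add: vec_eq_iff)+
  have inv: "?h (?h x) = x" for x
    by (simp add: vec_eq_iff)
  show "?h (?h x) = x" "?h (?h x) = x" for x
    by (rule inv)+
  show "measure lebesgue (?h ` cbox l u) = measure lebesgue (cbox l u)" for l u
  proof (cases "cbox l u = {}")
    case False
    have "?h ` cbox l u = cbox (?h l) (?h u)"
    proof (intro equalityI subsetI)
      fix x assume "x \<in> cbox (?h l) (?h u)"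
      then have "?h x \<in> cbox l u"
        by (simp add: mem_box_cart) (metis transpose_involutory)
      then show "x \<in> ?h ` cbox l u"
        by (metis inv image_eqI)
    qed (auto simp: mem_box_cart)
    moreover from this have "cbox (?h l) (?h u) \<noteq> {}"
      using False by blast
    moreover have "(\<Prod>i\<in>UNIV. ?h u $ i - ?h l $ i) = (\<Prod>i\<in>UNIV. u $ i - l $ i)"
      using prod.permute[OF permutes_swap_id, of m UNIV n "\<lambda>i. u $ i - l $ i"] by (simp add: o_def)
    ultimately show ?thesis
      using False by (simp add: content_cbox_cart)
  qed simp
qed

lemma lborel_distr_shear:
  assumes "m \<noteq> n"
  shows "lborel = distr lborel borel (\<lambda>x::real^'n. \<chi> i. if i = m then x $ m + x $ n else x $ i)"
    (is "_ = distr _ _ ?h")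
proof (rule lborel_distr_linear_bij[where g = "\<lambda>x. \<chi> i. if i = m then x $ m - x $ n else x $ i"])
  show lin: "linear ?h"
    by (rule linearI) (auto simp: vec_eq_iff algebra_simps)
  show "linear (\<lambda>x::real^'n. \<chi> i. if i = m then x $ m - x $ n else x $ i)"
    by (rule linearI) (auto simp: vec_eq_iff algebra_simps)
  show "measure lebesgue (?h ` cbox l u) = measure lebesgue (cbox l u)" for l u
  proof (cases "cbox l u = {}")
    case False
    \<comment> \<open>The box is translated so that its lower corner is 0, a position to which
      \<open>measure_shear_interval\<close> applies. By linearity the sheared box is a translate of
      the shear of this one.\<close>
    have box: "cbox l u = (+) l ` cbox 0 (u - l)"
      by (simp add: cbox_translation[symmetric])
    have "?h ` cbox l u = (+) (?h l) ` ?h ` cbox 0 (u - l)"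
      unfolding box image_image using linear_add[OF lin, of l] by simp
    moreover have "cbox 0 (u - l) \<noteq> {}"
      using False box by auto
    ultimately show ?thesis
      using assms box
      by (simp add: measure_translation measure_shear_interval del: measure_completion)
  qed simp
qed (use assms in \<open>auto simp: vec_eq_iff\<close>)

lemma lborel_distr_diagonal:
  fixes A :: "real^'n^'n"
  assumes "\<And>i j. i \<noteq> j \<Longrightarrow> A $ i $ j = 0" and "det A \<noteq> 0"
  shows "lborel = density (distr lborel borel ((*v) A)) (\<lambda>_. ennreal \<bar>det A\<bar>)"
proof -
  have det: "det A = (\<Prod>i\<in>UNIV. A $ i $ i)"
    using assms(1) by (rule det_diagonal)
  have nz: "A $ i $ i \<noteq> 0" for i
    using assms(2) det by auto
  \<comment> \<open>\<open>lborel_affine_euclidean\<close> takes scaling factors indexed by basis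
    vectors, not by coordinates. This linear functional has the diagonal entry
    \<open>A $ i $ i\<close> as its value at \<open>axis i 1\<close>.\<close>
  define c where "c v = (\<Sum>i\<in>UNIV. A $ i $ i * v $ i)" for v :: "real^'n"
  have c: "c (axis i 1) = A $ i $ i" for i
    by (simp add: c_def axis_def if_distrib cong: if_cong)
  have Basis: "(Basis :: (real^'n) set) = (\<lambda>i. axis i 1) ` UNIV"
    by (auto simp: Basis_vec_def)
  have inj: "inj (\<lambda>i::'n. axis i (1::real))"
    by (auto simp: inj_def axis_eq_axis)
  have map: "0 + (\<Sum>j\<in>Basis. (c j * (x \<bullet> j)) *\<^sub>R j) = A *v x" for x
  proof -
    have "(\<Sum>j\<in>UNIV. A $ i $ j * x $ j) = A $ i $ i * x $ i" for i
      using assms(1) by (subst sum.remove[of _ i]) auto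
    then show ?thesis
      unfolding Basis
      by (subst sum.reindex[OF inj], simp add: vec_eq_iff c matrix_vector_mult_def inner_axis)
         (simp add: axis_def if_distrib cong: if_cong)
  qed
  have "(\<Prod>j\<in>Basis. \<bar>c j\<bar>) = \<bar>det A\<bar>"
    unfolding Basis det by (subst prod.reindex[OF inj]) (simp add: c abs_prod)
  moreover have "c j \<noteq> 0" if "j \<in> Basis" for j
    using that nz c by (auto simp: Basis)
  ultimately show ?thesis
    using lborel_affine_euclidean[of c 0, unfolded map] by simp
qed

lemma measurable_matrix_vector_mult [measurable]:
  "(*v) (A :: real^'n^'m) \<in> borel_measurable borel"
  by (intro borel_measurable_continuous_onI linear_continuous_on matrix_vector_mul_bounded_linear)

text \<open>The formula is multiplicative in \<open>A\<close>, so elementary factors suffice. The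
  factorization covers singular matrices too, hence \<open>det A \<noteq> 0\<close> stands inside
  the induction claim: it passes from a product to both factors and makes the case of a zero row
  vacuous.\<close>

lemma lborel_distr_matrix:
  fixes A :: "real^'n^'n"
  shows "det A \<noteq> 0 \<longrightarrow> lborel = density (distr lborel borel ((*v) A)) (\<lambda>_. ennreal \<bar>det A\<bar>)"
proof (induction A rule: induct_matrix_elementary_alt)
  case (1 A B)
  show ?case
  proof
    assume AB: "det (A ** B) \<noteq> 0"
    then have nz: "det A \<noteq> 0" "det B \<noteq> 0"
      by (auto simp: det_mul)
    have "lborel = density (distr lborel borel ((*v) A)) (\<lambda>_. ennreal \<bar>det A\<bar>)"
      using 1 nz by blast
    \<comment> \<open>The formula for \<open>B\<close> replaces the inner \<open>lborel\<close>. Its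
      density is constant, so it passes through the pushforward by \<open>A\<close> and is
      multiplied by \<open>\<bar>det A\<bar>\<close>.\<close>
    also have "distr lborel borel ((*v) A) =
        distr (density (distr lborel borel ((*v) B)) (\<lambda>_. ennreal \<bar>det B\<bar>)) borel ((*v) A)"
      using 1 nz by metis
    also have "\<dots> = density (distr (distr lborel borel ((*v) B)) borel ((*v) A)) (\<lambda>_. ennreal \<bar>det B\<bar>)"
      by (subst density_distr) simp_all
    also have "distr (distr lborel borel ((*v) B)) borel ((*v) A) = distr lborel borel ((*v) (A ** B))"
      by (subst distr_distr) (simp_all add: o_def matrix_vector_mul_assoc)
    finally show "lborel = density (distr lborel borel ((*v) (A ** B))) (\<lambda>_. ennreal \<bar>det (A ** B)\<bar>)"
      by (simp add: density_density_eq det_mul abs_mult ennreal_mult mult.commute)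
  qed
next
  case (2 A i)
  then show ?case
    using det_zero_row(1)[of i A] by (simp add: row_def vec_eq_iff)
next
  case (3 A)
  then show ?case
    using lborel_distr_diagonal by blast
next
  case (4 m n)
  let ?A = "\<chi> i j. mat 1 $ i $ Transposition.transpose m n j :: real^'n^'n"
  \<comment> \<open>The identity matrix with permuted columns is the transpose of the one with
    permuted rows, whose determinant is the sign of the permutation; only its absolute value
    enters.\<close>
  have "?A = transpose (\<chi> i. mat 1 $ Transposition.transpose m n i)"
    by (auto simp: vec_eq_iff transpose_def mat_def)
  then have "det ?A = of_int (sign (Transposition.transpose m n))"
    by (simp add: det_permute_rows permutes_swap_id)
  then have "\<bar>det ?A\<bar> = 1"
    by (simp add: sign_def)
  moreover have "(*v) ?A = (\<lambda>x. \<chi> i. x $ Transposition.transpose m n i)"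
  proof
    fix x :: "real^'n"
    have "(\<Sum>j\<in>UNIV. mat 1 $ i $ Transposition.transpose m n j * x $ j) = x $ Transposition.transpose m n i" for i
    proof -
      have "i = Transposition.transpose m n j \<longleftrightarrow> Transposition.transpose m n i = j" for j
        by (metis transpose_involutory)
      then show ?thesis
        by (simp add: mat_def if_distrib[of "\<lambda>u. u * _"] cong: if_cong)
    qed
    then show "?A *v x = (\<chi> i. x $ Transposition.transpose m n i)"
      by (simp add: matrix_vector_mult_def)
  qed
  ultimately show ?case
    using lborel_distr_transpose[of m n] by (simp add: density_1)
next
  case (5 m n)
  let ?A = "\<chi> i j. of_bool (i = m \<and> j = n \<or> i = j) :: real^'n^'n"
  have "?A = (\<chi> k. if k = m then row m (mat 1) + 1 *s row n (mat 1) else row k (mat 1))"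
    using 5 by (auto simp: vec_eq_iff row_def mat_def)
  then have "det ?A = 1"
    using det_row_operation[OF 5, of "mat 1" "1::real"] by simp
  moreover have "(*v) ?A = (\<lambda>x. \<chi> i. if i = m then x $ m + x $ n else x $ i)"
  proof
    fix x :: "real^'n"
    have "(\<Sum>j\<in>UNIV. of_bool (i = m \<and> j = n \<or> i = j) * x $ j) = (if i = m then x $ m + x $ n else x $ i)" for i
    proof -
      have "of_bool (i = m \<and> j = n \<or> i = j) * x $ j =
          (if n = j then (if i = m then x $ j else 0) else 0) + (if i = j then x $ j else 0)" for j
        using 5 by auto
      then show ?thesis
        by (simp add: sum.distrib)
    qed
    then show "?A *v x = (\<chi> i. if i = m then x $ m + x $ n else x $ i)"
      by (simp add: matrix_vector_mult_def)
  qed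
  ultimately show ?case
    using lborel_distr_shear[OF 5] by (simp add: density_1)
qed

section \<open>Affine substitution in integrals, from Borel to Lebesgue measurable functions\<close>

lemma nn_integral_lborel_affine_matrix:
  fixes A :: "real^'n^'n" and f :: "real^'n \<Rightarrow> ennreal"
  assumes "det A \<noteq> 0" and [measurable]: "f \<in> borel_measurable borel"
  shows "(\<integral>\<^sup>+x. f x \<partial>lborel) = ennreal \<bar>det A\<bar> * (\<integral>\<^sup>+x. f (A *v x + t) \<partial>lborel)"
proof -
  have "(\<integral>\<^sup>+x. f x \<partial>lborel) = (\<integral>\<^sup>+x. f (x + t) \<partial>lborel)"
    by (subst lborel_distr_plus[of t, symmetric]) (simp add: nn_integral_distr add.commute)
  also have "\<dots> = (\<integral>\<^sup>+x. f (x + t) \<partial>density (distr lborel borel ((*v) A)) (\<lambda>_. ennreal \<bar>det A\<bar>))"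
    using lborel_distr_matrix assms(1) by metis
  also have "\<dots> = ennreal \<bar>det A\<bar> * (\<integral>\<^sup>+x. f (A *v x + t) \<partial>lborel)"
    by (simp add: nn_integral_density nn_integral_distr nn_integral_cmult)
  finally show ?thesis .
qed

text \<open>Continuity gives Borel preimages of Borel sets only. Lebesgue sets differ from these by
  null sets, so it remains that preimages of null sets are null; this is the change of variables
  applied to the indicator of a null set.\<close>

lemma measurable_lebesgue_affine_matrix:
  fixes A :: "real^'n^'n"
  assumes "det A \<noteq> 0"
  shows "(\<lambda>x. A *v x + t) \<in> lebesgue \<rightarrow>\<^sub>M lebesgue"
proof (rule completion.measurable_completion2)
  have [measurable]: "(\<lambda>x. A *v x + t) \<in> lborel \<rightarrow>\<^sub>M lborel"
    by simp
  then show m: "(\<lambda>x. A *v x + t) \<in> lebesgue \<rightarrow>\<^sub>M lborel"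
    by (rule measurable_completion)
  show "null_sets lborel \<subseteq> null_sets (distr lebesgue lborel (\<lambda>x. A *v x + t))"
  proof
    fix N :: "(real^'n) set" assume N: "N \<in> null_sets lborel"
    then have [measurable]: "N \<in> sets borel" by auto
    have "0 = (\<integral>\<^sup>+x. indicator N x \<partial>lborel)"
      using N by auto
    also have "\<dots> = ennreal \<bar>det A\<bar> * (\<integral>\<^sup>+x. indicator N (A *v x + t) \<partial>lborel)"
      by (rule nn_integral_lborel_affine_matrix[OF assms]) simp
    finally have "(\<integral>\<^sup>+x. indicator N (A *v x + t) \<partial>lborel) = 0"
      using assms by (simp add: ennreal_eq_0_iff)
    also have "(\<integral>\<^sup>+x. indicator N (A *v x + t) \<partial>lborel) = (\<integral>\<^sup>+x. indicator N x \<partial>distr lborel lborel (\<lambda>x. A *v x + t))"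
      by (subst nn_integral_distr) simp_all
    finally show "N \<in> null_sets (distr lebesgue lborel (\<lambda>x. A *v x + t))"
      by (simp add: distr_completion null_sets_def)
  qed
qed

text \<open>\<open>f\<close> agrees with a Borel function outside a null set \<open>N\<close>. The
  affine preimage of \<open>N\<close> is null as well, so both integrals may be computed with the
  Borel function.\<close>

lemma nn_integral_lebesgue_affine_matrix:
  fixes A :: "real^'n^'n" and f :: "real^'n \<Rightarrow> ennreal"
  assumes A: "det A \<noteq> 0" and f: "f \<in> borel_measurable lebesgue"
  shows "(\<integral>\<^sup>+x. f x \<partial>lebesgue) = ennreal \<bar>det A\<bar> * (\<integral>\<^sup>+x. f (A *v x + t) \<partial>lebesgue)"
proof -
  obtain g where g: "g \<in> borel_measurable lborel" and ae: "AE x in lborel. f x = g x"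
    using completion_ex_borel_measurable[OF f] by blast
  obtain N where N: "N \<in> null_sets lborel" "{x. f x \<noteq> g x} \<subseteq> N"
    using ae by (auto elim!: AE_E simp: null_sets_def)
  then have [measurable]: "N \<in> sets borel" by auto
  have "0 = (\<integral>\<^sup>+x. indicator N x \<partial>lborel)"
    using N by auto
  also have "\<dots> = ennreal \<bar>det A\<bar> * (\<integral>\<^sup>+x. indicator N (A *v x + t) \<partial>lborel)"
    by (rule nn_integral_lborel_affine_matrix[OF A]) simp
  finally have "(\<integral>\<^sup>+x. indicator N (A *v x + t) \<partial>lborel) = 0"
    using A by (simp add: ennreal_eq_0_iff)
  then have "AE x in lborel. indicator N (A *v x + t) = (0::ennreal)"
    by (subst (asm) nn_integral_0_iff_AE) simp_all
  then have ae': "AE x in lborel. f (A *v x + t) = g (A *v x + t)"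
    using N(2) by (auto elim!: eventually_mono simp: indicator_def split: if_splits)
  have "(\<integral>\<^sup>+x. f x \<partial>lebesgue) = (\<integral>\<^sup>+x. g x \<partial>lborel)"
    unfolding nn_integral_completion by (rule nn_integral_cong_AE[OF ae])
  also have "\<dots> = ennreal \<bar>det A\<bar> * (\<integral>\<^sup>+x. g (A *v x + t) \<partial>lborel)"
    using g by (intro nn_integral_lborel_affine_matrix[OF A]) simp
  also have "(\<integral>\<^sup>+x. g (A *v x + t) \<partial>lborel) = (\<integral>\<^sup>+x. f (A *v x + t) \<partial>lebesgue)"
    unfolding nn_integral_completion using ae' by (intro nn_integral_cong_AE) auto
  finally show ?thesis .
qed

subsection \<open>Series in \<open>L\<^sup>p\<close> for \<open>p \<le> 1\<close>\<close>

text \<open>Divide by the total \<open>S\<close>: each quotient lies in [0, 1], where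
  \<open>t \<le> t powr p\<close> because \<open>p \<le> 1\<close>, and the quotients add up to
  1.\<close>

lemma powr_sum_le_sum_powr:
  fixes a :: "'i \<Rightarrow> real"
  assumes p: "0 < p" "p \<le> 1" and nonneg: "\<And>i. i \<in> F \<Longrightarrow> 0 \<le> a i" and fin: "finite F"
  shows "(\<Sum>i\<in>F. a i) powr p \<le> (\<Sum>i\<in>F. a i powr p)"
proof (cases "(\<Sum>i\<in>F. a i) = 0")
  case True
  then show ?thesis by (simp add: sum_nonneg)
next
  case False
  define S where "S = (\<Sum>i\<in>F. a i)"
  have S: "S > 0"
    using False sum_nonneg[of F a] nonneg by (simp add: S_def order_less_le)
  have "a i / S \<le> a i powr p / S powr p" if "i \<in> F" for i
  proof -
    have "0 \<le> a i / S" "a i / S \<le> 1"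
      using that S nonneg member_le_sum[of i F a] fin by (auto simp: S_def)
    then have "(a i / S) powr 1 \<le> (a i / S) powr p"
      using powr_mono'[of p 1 "a i / S"] p by simp
    then show ?thesis
      using that S nonneg by (simp add: powr_divide)
  qed
  then have "(\<Sum>i\<in>F. a i / S) \<le> (\<Sum>i\<in>F. a i powr p / S powr p)"
    by (rule sum_mono)
  then have "1 \<le> (\<Sum>i\<in>F. a i powr p) / S powr p"
    using S by (simp add: S_def flip: sum_divide_distrib)
  then show ?thesis
    using S by (simp add: field_simps S_def)
qed

lemma powr_add_le_add_powr:
  assumes "0 < p" "p \<le> 1" "0 \<le> a" "0 \<le> b"
  shows "(a + b) powr p \<le> a powr p + b powr (p::real)"
  using powr_sum_le_sum_powr[of p "UNIV :: bool set" "\<lambda>t. if t then a else b"] assms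
  by (simp add: UNIV_bool add.commute)

text \<open>The finite inequality bounds every partial sum by \<open>K powr (1 / p)\<close>. For
  nonnegative terms this yields both the summability and the bound on the sum.\<close>

lemma
  fixes a :: "'i \<Rightarrow> real"
  assumes p: "0 < p" "p \<le> 1" and nonneg: "\<And>i. i \<in> I \<Longrightarrow> 0 \<le> a i"
    and summable: "(\<lambda>i. a i powr p) summable_on I"
  shows summable_on_of_summable_on_powr: "a summable_on I"
    and infsum_powr_le: "(\<Sum>\<^sub>\<infinity>i\<in>I. a i) powr p \<le> (\<Sum>\<^sub>\<infinity>i\<in>I. a i powr p)"
proof -
  define K where "K = (\<Sum>\<^sub>\<infinity>i\<in>I. a i powr p)"
  have K: "0 \<le> K"
    unfolding K_def by (rule infsum_nonneg) simp
  have bound: "sum a F \<le> K powr (1 / p)" if F: "finite F" "F \<subseteq> I" for F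
  proof -
    have "sum a F powr p \<le> K"
      using powr_sum_le_sum_powr[OF p, of F a] finite_sum_le_infsum[OF summable F] nonneg F
      by (force simp: K_def)
    then have "(sum a F powr p) powr (1 / p) \<le> K powr (1 / p)"
      using p by (intro powr_mono2) auto
    moreover have "0 \<le> sum a F"
      using nonneg F by (intro sum_nonneg) auto
    ultimately show ?thesis
      using p by (simp add: powr_powr)
  qed
  show *: "a summable_on I"
    using nonneg bound by (intro nonneg_bdd_above_summable_on) (auto intro!: bdd_aboveI)
  have "infsum a I \<le> K powr (1 / p)"
    using * bound by (rule infsum_le_finite_sums)
  then have "infsum a I powr p \<le> (K powr (1 / p)) powr p"
    using p nonneg by (intro powr_mono2) (auto intro: infsum_nonneg)
  then show "infsum a I powr p \<le> (\<Sum>\<^sub>\<infinity>i\<in>I. a i powr p)"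
    using p K by (simp add: powr_powr K_def)
qed

section \<open>Unordered sums as integrals over counting measure\<close>

lemma summable_on_iff_nn_integral_count_space:
  fixes a :: "'i \<Rightarrow> real"
  assumes "\<And>i. i \<in> I \<Longrightarrow> 0 \<le> a i"
  shows "a summable_on I \<longleftrightarrow> (\<integral>\<^sup>+i. ennreal (a i) \<partial>count_space I) < \<infinity>"
proof -
  have "a summable_on I \<longleftrightarrow> integrable (count_space I) a"
    using summable_on_iff_abs_summable_on_real abs_summable_equivalent
    unfolding Infinite_Set_Sum.abs_summable_on_def by metis
  also have "\<dots> \<longleftrightarrow> (\<integral>\<^sup>+i. ennreal (norm (a i)) \<partial>count_space I) < \<infinity>"
    by (simp add: integrable_iff_bounded)
  also have "(\<integral>\<^sup>+i. ennreal (norm (a i)) \<partial>count_space I) = (\<integral>\<^sup>+i. ennreal (a i) \<partial>count_space I)"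
    using assms by (intro nn_integral_cong) simp
  finally show ?thesis .
qed

text \<open>The equation extends to families that are not summable, since both sides then take the
  default value 0. The hypothesis rules out a sum that exists without absolute convergence, where
  only the integral would be 0.\<close>

lemma infsum_eq_integral_count_space:
  fixes a :: "'i \<Rightarrow> 'b::{banach, second_countable_topology}"
  assumes "a summable_on I \<Longrightarrow> (\<lambda>i. norm (a i)) summable_on I"
  shows "infsum a I = (LINT i|count_space I. a i)"
proof (cases "Infinite_Set_Sum.abs_summable_on a I")
  case True
  then show ?thesis
    using infsetsum_infsum[OF True] by (simp add: infsetsum_def)
next
  case False
  then have "\<not> a summable_on I"
    using abs_summable_equivalent[of a I] assms by auto
  with False show ?thesis
    by (simp add: infsum_not_exists Infinite_Set_Sum.abs_summable_on_def not_integrable_integral_eq)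
qed

lemma nn_integral_count_space_eq_infsum:
  fixes a :: "'i \<Rightarrow> real"
  assumes "\<And>i. i \<in> I \<Longrightarrow> 0 \<le> a i" and "a summable_on I"
  shows "(\<integral>\<^sup>+i. ennreal (a i) \<partial>count_space I) = ennreal (\<Sum>\<^sub>\<infinity>i\<in>I. a i)"
proof -
  have "integrable (count_space I) a"
    using assms(2) summable_on_iff_abs_summable_on_real abs_summable_equivalent
    unfolding Infinite_Set_Sum.abs_summable_on_def by metis
  then show ?thesis
    using assms summable_on_iff_abs_summable_on_real[of a I]
    by (subst infsum_eq_integral_count_space) (auto simp: nn_integral_eq_integral AE_count_space)
qed

text \<open>The sum is an integral over a countable counting measure, and such an integral is
  measurable in its parameter. Points of divergence are covered, as the two default values agree;
  for complex terms summability is absolute.\<close>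

lemma borel_measurable_infsum:
  fixes u :: "'i \<Rightarrow> 'a \<Rightarrow> complex"
  assumes "countable I" and u: "\<And>i. i \<in> I \<Longrightarrow> u i \<in> borel_measurable M"
  shows "(\<lambda>x. \<Sum>\<^sub>\<infinity>i\<in>I. u i x) \<in> borel_measurable M"
proof -
  interpret sigma_finite_measure "count_space I"
    using assms(1) by (rule sigma_finite_measure_count_space_countable)
  have "(\<lambda>(i, x). u i x) \<in> borel_measurable (count_space I \<Otimes>\<^sub>M M)"
    using assms by (intro measurable_pair_measure_countable1) auto
  then have "(\<lambda>(x, i). u i x) \<in> borel_measurable (M \<Otimes>\<^sub>M count_space I)"
    by (subst (asm) measurable_pair_swap_iff) (simp add: case_prod_unfold)
  then show ?thesis
    by (subst infsum_eq_integral_count_space)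
      (simp_all add: borel_measurable_lebesgue_integral flip: summable_on_iff_abs_summable_on_complex)
qed

lemma
  fixes u :: "'i \<Rightarrow> 'a \<Rightarrow> complex"
  assumes I: "countable I" and p: "0 < p" "p \<le> 1"
    and u: "\<And>i. i \<in> I \<Longrightarrow> u i \<in> borel_measurable M"
    and int: "\<And>i. i \<in> I \<Longrightarrow> integrable M (\<lambda>x. norm (u i x) powr p)"
    and sum: "(\<lambda>i. LINT x|M. norm (u i x) powr p) summable_on I"
  shows AE_summable_powr_series: "AE x in M. (\<lambda>i. norm (u i x)) summable_on I"
    and integrable_powr_series: "integrable M (\<lambda>x. norm (\<Sum>\<^sub>\<infinity>i\<in>I. u i x) powr p)"
    and integral_powr_series_le:
      "(LINT x|M. norm (\<Sum>\<^sub>\<infinity>i\<in>I. u i x) powr p) \<le> (\<Sum>\<^sub>\<infinity>i\<in>I. LINT x|M. norm (u i x) powr p)"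
proof -
  let ?K = "\<Sum>\<^sub>\<infinity>i\<in>I. LINT x|M. norm (u i x) powr p"
  \<comment> \<open>The majorant of the \<open>p\<close>-th power of the sum. With values in
    \<open>ennreal\<close> it is infinite where the series of \<open>p\<close>-th powers diverges,
    so that the bound holds at every point; Tonelli gives its integral as \<open>?K\<close>, hence
    it is finite almost everywhere.\<close>
  define G where "G x = (\<integral>\<^sup>+i. ennreal (norm (u i x) powr p) \<partial>count_space I)" for x
  have m: "(\<lambda>x. ennreal (norm (u i x) powr p)) \<in> borel_measurable M" if "i \<in> I" for i
    using u[OF that] by measurable
  have f: "(\<lambda>x. \<Sum>\<^sub>\<infinity>i\<in>I. u i x) \<in> borel_measurable M"
    using I u by (rule borel_measurable_infsum)
  have K0: "0 \<le> ?K"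
    by (intro infsum_nonneg) simp
  have "(\<integral>\<^sup>+x. G x \<partial>M) = (\<integral>\<^sup>+i. \<integral>\<^sup>+x. ennreal (norm (u i x) powr p) \<partial>M \<partial>count_space I)"
    unfolding G_def using I m by (rule nn_integral_count_space_nn_integral)
  also have "\<dots> = (\<integral>\<^sup>+i. ennreal (LINT x|M. norm (u i x) powr p) \<partial>count_space I)"
    using int by (intro nn_integral_cong) (simp add: nn_integral_eq_integral)
  also have "\<dots> = ennreal ?K"
    using sum by (intro nn_integral_count_space_eq_infsum) simp_all
  finally have G: "(\<integral>\<^sup>+x. G x \<partial>M) = ennreal ?K" .
  have G_meas: "G \<in> borel_measurable M"
  proof -
    interpret sigma_finite_measure "count_space I"
      using I by (rule sigma_finite_measure_count_space_countable)
    have "(\<lambda>(i, x). ennreal (norm (u i x) powr p)) \<in> borel_measurable (count_space I \<Otimes>\<^sub>M M)"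
      using I m by (intro measurable_pair_measure_countable1) auto
    then have "(\<lambda>(x, i). ennreal (norm (u i x) powr p)) \<in> borel_measurable (M \<Otimes>\<^sub>M count_space I)"
      by (subst (asm) measurable_pair_swap_iff) (simp add: case_prod_unfold)
    then show ?thesis
      unfolding G_def by (rule borel_measurable_nn_integral)
  qed
  have finite_G: "AE x in M. G x \<noteq> \<infinity>"
    using G_meas G by (intro nn_integral_noteq_infinite) simp_all
  have powr_summable: "(\<lambda>i. norm (u i x) powr p) summable_on I" if "G x \<noteq> \<infinity>" for x
    using that by (subst summable_on_iff_nn_integral_count_space) (auto simp: G_def top.not_eq_extremum)
  show "AE x in M. (\<lambda>i. norm (u i x)) summable_on I"
    using finite_G
  proof eventually_elim
    case (elim x)
    show ?case
      using powr_summable[OF elim] by (rule summable_on_of_summable_on_powr[OF p, rotated]) simp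
  qed
  have "ennreal (norm (\<Sum>\<^sub>\<infinity>i\<in>I. u i x) powr p) \<le> G x" for x
  proof (cases "G x = \<infinity>")
    case False
    note sx = powr_summable[OF this]
    have ax: "(\<lambda>i. norm (u i x)) summable_on I"
      using sx by (rule summable_on_of_summable_on_powr[OF p, rotated]) simp
    have "norm (\<Sum>\<^sub>\<infinity>i\<in>I. u i x) powr p \<le> (\<Sum>\<^sub>\<infinity>i\<in>I. norm (u i x)) powr p"
      using p norm_infsum_bound[OF ax] by (intro powr_mono2) auto
    also have "\<dots> \<le> (\<Sum>\<^sub>\<infinity>i\<in>I. norm (u i x) powr p)"
      using sx by (rule infsum_powr_le[OF p, rotated]) simp
    finally show ?thesis
      using nn_integral_count_space_eq_infsum[OF _ sx] by (simp add: G_def ennreal_leI)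
  qed simp
  then have bound: "(\<integral>\<^sup>+x. ennreal (norm (\<Sum>\<^sub>\<infinity>i\<in>I. u i x) powr p) \<partial>M) \<le> ennreal ?K"
    unfolding G[symmetric] by (rule nn_integral_mono)
  show intf: "integrable M (\<lambda>x. norm (\<Sum>\<^sub>\<infinity>i\<in>I. u i x) powr p)"
  proof (rule integrableI_bounded)
    show "(\<lambda>x. norm (\<Sum>\<^sub>\<infinity>i\<in>I. u i x) powr p) \<in> borel_measurable M"
      using f by measurable
    show "(\<integral>\<^sup>+x. ennreal (norm (norm (\<Sum>\<^sub>\<infinity>i\<in>I. u i x) powr p)) \<partial>M) < \<infinity>"
      using bound by (simp add: le_less_trans[OF _ ennreal_less_top])
  qed
  show "(LINT x|M. norm (\<Sum>\<^sub>\<infinity>i\<in>I. u i x) powr p) \<le> ?K"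
    using bound K0 by (subst (asm) nn_integral_eq_integral[OF intf]) simp_all
qed

section \<open>Countable subadditivity and unconditional convergence in
  \<open>Lp_space\<close>\<close>

lemma Lp_norm_powr: "p \<noteq> 0 \<Longrightarrow> Lp_norm p f powr p = (LINT x|lebesgue. norm (f x) powr p)"
  by (simp add: Lp_norm_def powr_powr)

lemma lp_norm_powr: "p \<noteq> 0 \<Longrightarrow> lp_norm p c powr p = (\<Sum>\<^sub>\<infinity>i\<in>index_set. norm (c i) powr p)"
  by (simp add: lp_norm_def powr_powr infsum_nonneg)

lemma Lp_norm_cong_AE:
  assumes [measurable]: "f \<in> borel_measurable lebesgue" "g \<in> borel_measurable lebesgue"
    and "AE x in lebesgue. norm (f x) = norm (g x)"
  shows "Lp_norm p f = Lp_norm p g"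
proof -
  have "(LINT x|lebesgue. norm (f x) powr p) = (LINT x|lebesgue. norm (g x) powr p)"
    proof (rule integral_cong_AE)
    show "AE x in lebesgue. norm (f x) powr p = norm (g x) powr p"
      using assms(3) by eventually_elim simp
  qed measurable
  then show ?thesis
    by (simp add: Lp_norm_def)
qed

text \<open>For \<open>p < 1\<close> the triangle inequality may fail for \<open>Lp_norm\<close>,
  while its \<open>p\<close>-th power is subadditive; summability is therefore asked of the
  \<open>p\<close>-th powers.\<close>

lemma
  fixes u :: "'i \<Rightarrow> real^'n \<Rightarrow> complex"
  assumes I: "countable I" and p: "0 < p" "p \<le> 1"
    and u: "\<And>i. i \<in> I \<Longrightarrow> u i \<in> Lp_space p"
    and sum: "(\<lambda>i. Lp_norm p (u i) powr p) summable_on I"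
  shows AE_summable_Lp_series: "AE x in lebesgue. (\<lambda>i. norm (u i x)) summable_on I"
    and Lp_norm_infsum_powr_le:
      "Lp_norm p (\<lambda>x. \<Sum>\<^sub>\<infinity>i\<in>I. u i x) powr p \<le> (\<Sum>\<^sub>\<infinity>i\<in>I. Lp_norm p (u i) powr p)"
    and Lp_has_sum_infsum: "Lp_has_sum p u I (\<lambda>x. \<Sum>\<^sub>\<infinity>i\<in>I. u i x)"
proof -
  let ?f = "\<lambda>J x. \<Sum>\<^sub>\<infinity>i\<in>J. u i x" and ?N = "\<lambda>i. Lp_norm p (u i) powr p"
  have meas: "u i \<in> borel_measurable lebesgue"
    and int: "integrable lebesgue (\<lambda>x. norm (u i x) powr p)" if "i \<in> I" for i
    using u[OF that] by (auto simp: Lp_space_def)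
  \<comment> \<open>Stated for all subsets \<open>J\<close>, because \<open>J = I - F\<close> gives
    the remainder of the partial sum over \<open>F\<close>.\<close>
  have series: "AE x in lebesgue. (\<lambda>i. norm (u i x)) summable_on J"
      "Lp_norm p (?f J) powr p \<le> (\<Sum>\<^sub>\<infinity>i\<in>J. ?N i)" "?f J \<in> Lp_space p" if J: "J \<subseteq> I" for J
  proof -
    have "(\<lambda>i. LINT x|lebesgue. norm (u i x) powr p) summable_on J"
      using summable_on_subset_banach[OF sum J] p by (simp add: Lp_norm_powr)
    note prems = countable_subset[OF J I] p meas[OF subsetD[OF J]] int[OF subsetD[OF J]] this
    show "AE x in lebesgue. (\<lambda>i. norm (u i x)) summable_on J"
      by (rule AE_summable_powr_series[OF prems])
    show "Lp_norm p (?f J) powr p \<le> (\<Sum>\<^sub>\<infinity>i\<in>J. ?N i)"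
      using integral_powr_series_le[OF prems] p by (simp add: Lp_norm_powr)
    show "?f J \<in> Lp_space p"
      using integrable_powr_series[OF prems] borel_measurable_infsum[OF prems(1,4)]
      by (simp add: Lp_space_def)
  qed
  show "AE x in lebesgue. (\<lambda>i. norm (u i x)) summable_on I"
    and "Lp_norm p (?f I) powr p \<le> (\<Sum>\<^sub>\<infinity>i\<in>I. ?N i)"
    using series[of I] by auto
  have dist: "Lp_dist p (\<lambda>x. \<Sum>i\<in>F. u i x) (?f I) \<le> infsum ?N I - sum ?N F"
    if F: "finite F" "F \<subseteq> I" for F
  proof -
    \<comment> \<open>This may fail where the full series diverges: both infinite sums are then 0 by
      default, while the finite sum may be nonzero.\<close>
    have "AE x in lebesgue. (\<Sum>i\<in>F. u i x) - ?f I x = - ?f (I - F) x"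
      using series(1)[OF subset_refl]
    proof eventually_elim
      case (elim x)
      then have "(\<lambda>i. u i x) summable_on I"
        by (rule abs_summable_summable)
      then show ?case
        using F by (simp add: infsum_Diff)
    qed
    then have "AE x in lebesgue. norm ((\<Sum>i\<in>F. u i x) - ?f I x) = norm (?f (I - F) x)"
      by eventually_elim simp
    moreover have "(\<lambda>x. (\<Sum>i\<in>F. u i x) - ?f I x) \<in> borel_measurable lebesgue"
      using meas F series(3)[of I] by (intro borel_measurable_diff borel_measurable_sum) (auto simp: Lp_space_def)
    moreover have "?f (I - F) \<in> borel_measurable lebesgue"
      using series(3)[of "I - F"] by (auto simp: Lp_space_def)
    ultimately have "Lp_norm p (\<lambda>x. (\<Sum>i\<in>F. u i x) - ?f I x) = Lp_norm p (?f (I - F))"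
      by (intro Lp_norm_cong_AE)
    then have "Lp_dist p (\<lambda>x. \<Sum>i\<in>F. u i x) (?f I) = Lp_norm p (?f (I - F)) powr p"
      by (simp add: Lp_dist_def)
    also have "\<dots> \<le> infsum ?N (I - F)"
      by (rule series(2)) auto
    also have "\<dots> = infsum ?N I - sum ?N F"
      using F by (simp add: infsum_Diff[OF sum])
    finally show ?thesis .
  qed
  have "((\<lambda>F. infsum ?N I - sum ?N F) \<longlongrightarrow> infsum ?N I - infsum ?N I) (finite_subsets_at_top I)"
    by (intro tendsto_intros infsum_tendsto sum)
  then have lim: "((\<lambda>F. infsum ?N I - sum ?N F) \<longlongrightarrow> 0) (finite_subsets_at_top I)"
    by simp
  have "((\<lambda>F. Lp_dist p (\<lambda>x. \<Sum>i\<in>F. u i x) (?f I)) \<longlongrightarrow> 0) (finite_subsets_at_top I)"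
  proof (rule tendsto_sandwich[OF _ _ tendsto_const lim])
    show "\<forall>\<^sub>F F in finite_subsets_at_top I. 0 \<le> Lp_dist p (\<lambda>x. \<Sum>i\<in>F. u i x) (?f I)"
      by (simp add: Lp_dist_def)
    show "\<forall>\<^sub>F F in finite_subsets_at_top I.
        Lp_dist p (\<lambda>x. \<Sum>i\<in>F. u i x) (?f I) \<le> infsum ?N I - sum ?N F"
      using dist by (intro eventually_finite_subsets_at_top_weakI)
  qed
  then show "Lp_has_sum p u I (?f I)"
    using u series(3)[of I] by (simp add: Lp_has_sum_def)
qed

section \<open>The functions \<open>dilate_translate\<close> and the sequence space\<close>

text \<open>The \<open>p\<close>-th power of the factor
  \<open>\<bar>det (a j)\<bar> powr (1 / p)\<close> is the Jacobian of the substitution, so the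
  normalization leaves the norm of \<open>\<psi>\<close> unchanged.\<close>

lemma
  assumes det: "det (a j) \<noteq> 0" and p: "p \<noteq> 0" and \<psi>: "\<psi> \<in> Lp_space p"
  shows dilate_translate_in_Lp_space: "dilate_translate p a b \<psi> (j, k) \<in> Lp_space p"
    and Lp_norm_dilate_translate: "Lp_norm p (dilate_translate p a b \<psi> (j, k)) = Lp_norm p \<psi>"
proof -
  let ?D = "dilate_translate p a b \<psi> (j, k)"
  define t where "t = - (b *v (\<chi> i. of_int (k $ i)))"
  have D: "?D x = of_real (\<bar>det (a j)\<bar> powr (1 / p)) * \<psi> (a j *v x + t)" for x
    by (simp add: dilate_translate_def t_def)
  have meas_\<psi>: "\<psi> \<in> borel_measurable lebesgue"
    and int: "integrable lebesgue (\<lambda>x. norm (\<psi> x) powr p)"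
    using \<psi> by (auto simp: Lp_space_def)
  have comp: "(\<lambda>x. \<psi> (a j *v x + t)) \<in> borel_measurable lebesgue"
    using measurable_compose[OF measurable_lebesgue_affine_matrix[OF det] meas_\<psi>] .
  then have meas: "?D \<in> borel_measurable lebesgue"
    unfolding D by measurable
  have norm: "norm (?D x) powr p = \<bar>det (a j)\<bar> * norm (\<psi> (a j *v x + t)) powr p" for x
    using p by (simp add: D norm_mult powr_mult powr_powr)
  have "(\<integral>\<^sup>+x. ennreal (norm (?D x) powr p) \<partial>lebesgue) =
      (\<integral>\<^sup>+x. ennreal \<bar>det (a j)\<bar> * ennreal (norm (\<psi> (a j *v x + t)) powr p) \<partial>lebesgue)"
    by (simp add: norm ennreal_mult)
  also have "\<dots> = ennreal \<bar>det (a j)\<bar> * (\<integral>\<^sup>+x. ennreal (norm (\<psi> (a j *v x + t)) powr p) \<partial>lebesgue)"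
    using comp by (intro nn_integral_cmult) measurable
  also have "\<dots> = (\<integral>\<^sup>+x. ennreal (norm (\<psi> x) powr p) \<partial>lebesgue)"
    using meas_\<psi> by (intro nn_integral_lebesgue_affine_matrix[OF det, symmetric]) measurable
  also have "\<dots> = ennreal (LINT x|lebesgue. norm (\<psi> x) powr p)"
    using int by (simp add: nn_integral_eq_integral)
  finally have nn: "(\<integral>\<^sup>+x. ennreal (norm (?D x) powr p) \<partial>lebesgue) =
      ennreal (LINT x|lebesgue. norm (\<psi> x) powr p)" .
  have meas_powr: "(\<lambda>x. norm (?D x) powr p) \<in> borel_measurable lebesgue"
    using meas by measurable
  then have "integrable lebesgue (\<lambda>x. norm (?D x) powr p)"
    using nn by (intro integrableI_bounded) auto
  then show "?D \<in> Lp_space p"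
    using meas by (simp add: Lp_space_def)
  show "Lp_norm p ?D = Lp_norm p \<psi>"
    using meas_powr nn by (simp add: Lp_norm_def integral_eq_nn_integral)
qed

lemma
  assumes "p \<noteq> 0" and "f \<in> Lp_space p"
  shows Lp_space_cmult: "(\<lambda>x. r * f x) \<in> Lp_space p"
    and Lp_norm_cmult: "Lp_norm p (\<lambda>x. r * f x) = norm r * Lp_norm p f"
  using assms by (auto simp: Lp_space_def Lp_norm_def norm_mult powr_mult powr_powr)

lemma lp_space_lincomb:
  assumes p: "0 < p" "p \<le> 1" and c: "c \<in> lp_space p" "c' \<in> lp_space p"
  shows "(\<lambda>i. \<alpha> * c i + \<beta> * c' i) \<in> lp_space p"
proof -
  have bound: "norm (\<alpha> * c i + \<beta> * c' i) powr p
      \<le> norm \<alpha> powr p * norm (c i) powr p + norm \<beta> powr p * norm (c' i) powr p" for i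
  proof -
    have "norm (\<alpha> * c i + \<beta> * c' i) powr p \<le> (norm (\<alpha> * c i) + norm (\<beta> * c' i)) powr p"
      using p by (intro powr_mono2 norm_triangle_ineq) auto
    also have "\<dots> \<le> norm (\<alpha> * c i) powr p + norm (\<beta> * c' i) powr p"
      using p by (intro powr_add_le_add_powr) auto
    finally show ?thesis
      by (simp add: norm_mult powr_mult)
  qed
  have "(\<lambda>i. norm \<alpha> powr p * norm (c i) powr p + norm \<beta> powr p * norm (c' i) powr p) summable_on index_set"
    using c unfolding lp_space_def by (intro summable_on_add summable_on_cmult_right) auto
  then show ?thesis
    unfolding lp_space_def mem_Collect_eq
    by (rule summable_on_comparison_test) (use bound in auto)
qed

lemma countable_index_set: "countable (index_set :: (int \<times> (int^'n)) set)"
proof -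
  have "countable (UNIV :: (int^'n) set)"
  proof (rule countableI)
    \<comment> \<open>A vector is determined by its coordinate function, and functions from a finite
      type to \<open>int\<close> form a countable type.\<close>
    show "inj (\<lambda>k::int^'n. to_nat (vec_nth k))"
      by (simp add: inj_on_def vec_nth_inject)
  qed
  then show ?thesis
    unfolding index_set_def by (intro countable_SIGMA) auto
qed

section \<open>The synthesis operator: convergence, norm bound, linearity and continuity\<close>

text \<open>An instance of the series results: the \<open>i\<close>-th term has norm
  \<open>norm (c i) * Lp_norm p \<psi>\<close>, so the sum of the \<open>p\<close>-th powers factors
  into the norms of \<open>\<psi>\<close> and \<open>c\<close>.\<close>

lemma
  fixes a :: "int \<Rightarrow> real^'n^'n"
  assumes inv: "\<forall>j>0. invertible (a j)"
    and p: "0 < p" "p \<le> 1" and \<psi>: "\<psi> \<in> Lp_space p" and c: "c \<in> lp_space p"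
  shows AE_summable_synthesis:
      "AE x in lebesgue. (\<lambda>i. norm (c i * dilate_translate p a b \<psi> i x)) summable_on index_set"
    and Lp_has_sum_synthesis:
      "Lp_has_sum p (\<lambda>i x. c i * dilate_translate p a b \<psi> i x) index_set (synthesis p a b \<psi> c)"
    and Lp_norm_synthesis_le: "Lp_norm p (synthesis p a b \<psi> c) \<le> Lp_norm p \<psi> * lp_norm p c"
proof -
  let ?u = "\<lambda>i x. c i * dilate_translate p a b \<psi> i x"
  have D: "dilate_translate p a b \<psi> i \<in> Lp_space p"
    "Lp_norm p (dilate_translate p a b \<psi> i) = Lp_norm p \<psi>" if idx: "i \<in> index_set" for i
  proof -
    obtain j k where i: "i = (j, k)" "j > 0"
      using idx by (auto simp: index_set_def)
    then have "det (a j) \<noteq> 0"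
      using inv by (simp add: invertible_det_nz)
    then show "dilate_translate p a b \<psi> i \<in> Lp_space p"
      "Lp_norm p (dilate_translate p a b \<psi> i) = Lp_norm p \<psi>"
      using p \<psi> i by (auto intro!: dilate_translate_in_Lp_space Lp_norm_dilate_translate)
  qed
  have u: "?u i \<in> Lp_space p"
    and N: "Lp_norm p (?u i) powr p = Lp_norm p \<psi> powr p * norm (c i) powr p"
    if "i \<in> index_set" for i
    using p D[OF that] Lp_space_cmult[of p "dilate_translate p a b \<psi> i" "c i"]
      Lp_norm_cmult[of p "dilate_translate p a b \<psi> i" "c i"]
    by (auto simp: powr_mult mult.commute)
  have "(\<lambda>i. Lp_norm p \<psi> powr p * norm (c i) powr p) summable_on index_set"
    using c by (intro summable_on_cmult_right) (simp add: lp_space_def)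
  then have sum: "(\<lambda>i. Lp_norm p (?u i) powr p) summable_on index_set"
    using N by (simp cong: summable_on_cong)
  note prems = countable_index_set p u sum
  show "AE x in lebesgue. (\<lambda>i. norm (?u i x)) summable_on index_set"
    by (rule AE_summable_Lp_series[OF prems])
  show "Lp_has_sum p ?u index_set (synthesis p a b \<psi> c)"
    unfolding synthesis_def by (rule Lp_has_sum_infsum[OF prems])
  have "Lp_norm p (synthesis p a b \<psi> c) powr p \<le> (\<Sum>\<^sub>\<infinity>i\<in>index_set. Lp_norm p (?u i) powr p)"
    unfolding synthesis_def by (rule Lp_norm_infsum_powr_le[OF prems])
  also have "\<dots> = (Lp_norm p \<psi> * lp_norm p c) powr p"
    using p by (simp add: N infsum_cmult_right' powr_mult lp_norm_powr cong: infsum_cong)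
  \<comment> \<open>The \<open>p\<close>-th powers are already compared; strict monotonicity of
    \<open>powr\<close>, used by contraposition, removes the exponent.\<close>
  finally show "Lp_norm p (synthesis p a b \<psi> c) \<le> Lp_norm p \<psi> * lp_norm p c"
    using powr_less_mono2[of p "Lp_norm p \<psi> * lp_norm p c" "Lp_norm p (synthesis p a b \<psi> c)"] p
    by (force simp: Lp_norm_def lp_norm_def)
qed

text \<open>Convergence at the point \<open>x\<close> is assumed because the default value 0 of a
  divergent sum is not compatible with addition.\<close>

lemma synthesis_lincomb:
  assumes "(\<lambda>i. norm (c i * dilate_translate p a b \<psi> i x)) summable_on index_set"
    and "(\<lambda>i. norm (c' i * dilate_translate p a b \<psi> i x)) summable_on index_set"
  shows "synthesis p a b \<psi> (\<lambda>i. \<alpha> * c i + \<beta> * c' i) x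
    = \<alpha> * synthesis p a b \<psi> c x + \<beta> * synthesis p a b \<psi> c' x"
proof -
  let ?D = "\<lambda>i. dilate_translate p a b \<psi> i x"
  have s: "(\<lambda>i. c i * ?D i) summable_on index_set" "(\<lambda>i. c' i * ?D i) summable_on index_set"
    using assms by (auto intro: abs_summable_summable)
  have "(\<Sum>\<^sub>\<infinity>i\<in>index_set. \<alpha> * (c i * ?D i) + \<beta> * (c' i * ?D i)) =
      \<alpha> * (\<Sum>\<^sub>\<infinity>i\<in>index_set. c i * ?D i) + \<beta> * (\<Sum>\<^sub>\<infinity>i\<in>index_set. c' i * ?D i)"
    using s by (simp add: infsum_add summable_on_cmult_right infsum_cmult_right)
  then show ?thesis
    by (simp add: synthesis_def algebra_simps)
qed

text \<open>Almost everywhere the difference of the two images is the image of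
  \<open>c - c'\<close>, so the norm bound raised to the power \<open>p\<close> becomes a Lipschitz
  estimate between the two metrics.\<close>

lemma Lp_dist_synthesis_le:
  fixes a :: "int \<Rightarrow> real^'n^'n"
  assumes inv: "\<forall>j>0. invertible (a j)"
    and p: "0 < p" "p \<le> 1" and \<psi>: "\<psi> \<in> Lp_space p"
    and c: "c \<in> lp_space p" "c' \<in> lp_space p"
  shows "Lp_dist p (synthesis p a b \<psi> c) (synthesis p a b \<psi> c') \<le> Lp_norm p \<psi> powr p * lp_dist p c c'"
proof -
  let ?S = "synthesis p a b \<psi>" and ?d = "\<lambda>i. c i - c' i"
  have d: "?d \<in> lp_space p"
    using lp_space_lincomb[OF p c, of 1 "-1"] by simp
  have meas: "?S e \<in> borel_measurable lebesgue" if "e \<in> lp_space p" for e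
    using Lp_has_sum_synthesis[of a p \<psi> e b] inv p \<psi> that by (simp add: Lp_has_sum_def Lp_space_def)
  have "AE x in lebesgue. norm (?S c x - ?S c' x) = norm (?S ?d x)"
    using AE_summable_synthesis[OF inv p \<psi> c(1), of b]
      AE_summable_synthesis[OF inv p \<psi> c(2), of b]
  proof eventually_elim
    case (elim x)
    then show ?case
      using synthesis_lincomb[of c p a b \<psi> x c' 1 "-1"] by simp
  qed
  moreover have "(\<lambda>x. ?S c x - ?S c' x) \<in> borel_measurable lebesgue"
    using c by (intro borel_measurable_diff meas)
  ultimately have "Lp_norm p (\<lambda>x. ?S c x - ?S c' x) = Lp_norm p (?S ?d)"
    using meas[OF d] by (intro Lp_norm_cong_AE)
  then have "Lp_dist p (?S c) (?S c') = Lp_norm p (?S ?d) powr p"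
    by (simp add: Lp_dist_def)
  also have "\<dots> \<le> (Lp_norm p \<psi> * lp_norm p ?d) powr p"
    using p Lp_norm_synthesis_le[of a p \<psi> ?d b, OF inv p \<psi> d]
    by (intro powr_mono2) (auto simp: Lp_norm_def)
  finally show ?thesis
    by (simp add: lp_dist_def powr_mult Lp_norm_def lp_norm_def)
qed

theorem proposition1:
  fixes a :: "int \<Rightarrow> real ^ 'n ^ 'n"
    and b :: "real ^ 'n ^ 'n"
    and p :: real
    and \<psi> :: "real ^ 'n \<Rightarrow> complex"
  assumes "\<And>j. j > 0 \<Longrightarrow> invertible (a j)"
    and "((\<lambda>j. onorm (\<lambda>x. matrix_inv (a j) *v x)) \<longlongrightarrow> 0) at_top"
    and "invertible b"
    and "0 < p" and "p \<le> 1"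
    and "\<psi> \<in> Lp_space p"
  shows
    \<comment> \<open>pointwise absolute convergence almost everywhere, to a function in \<open>L\<^sup>p\<close>\<close>
    "(\<forall>c\<in>lp_space p.
        (AE x in lebesgue.
           (\<lambda>i. norm (c i * dilate_translate p a b \<psi> i x)) summable_on index_set) \<and>
        synthesis p a b \<psi> c \<in> Lp_space p \<and>
        Lp_has_sum p (\<lambda>i x. c i * dilate_translate p a b \<psi> i x) index_set (synthesis p a b \<psi> c) \<and>
        Lp_norm p (synthesis p a b \<psi> c) \<le> Lp_norm p \<psi> * lp_norm p c) \<and>
     \<comment> \<open>linearity\<close>
     (\<forall>c\<in>lp_space p. \<forall>c'\<in>lp_space p. \<forall>\<alpha> \<beta>.
        AE x in lebesgue.
          synthesis p a b \<psi> (\<lambda>i. \<alpha> * c i + \<beta> * c' i) x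
            = \<alpha> * synthesis p a b \<psi> c x + \<beta> * synthesis p a b \<psi> c' x) \<and>
     \<comment> \<open>continuity\<close>
     (\<forall>c\<in>lp_space p. \<forall>\<epsilon>>0. \<exists>\<delta>>0. \<forall>c'\<in>lp_space p.
        lp_dist p c c' < \<delta> \<longrightarrow> Lp_dist p (synthesis p a b \<psi> c) (synthesis p a b \<psi> c') < \<epsilon>)"
proof -
  have "\<forall>j>0. invertible (a j)"
    using assms(1) by blast
  note prems = this assms(4,5,6)
  show ?thesis
  proof (intro conjI ballI allI impI)
    fix c :: "int \<times> (int^'n) \<Rightarrow> complex" assume c: "c \<in> lp_space p"
    show "AE x in lebesgue. (\<lambda>i. norm (c i * dilate_translate p a b \<psi> i x)) summable_on index_set"
      by (rule AE_summable_synthesis[OF prems c])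
    show sum: "Lp_has_sum p (\<lambda>i x. c i * dilate_translate p a b \<psi> i x) index_set (synthesis p a b \<psi> c)"
      by (rule Lp_has_sum_synthesis[OF prems c])
    then show "synthesis p a b \<psi> c \<in> Lp_space p"
      by (simp add: Lp_has_sum_def)
    show "Lp_norm p (synthesis p a b \<psi> c) \<le> Lp_norm p \<psi> * lp_norm p c"
      by (rule Lp_norm_synthesis_le[OF prems c])
  next
    fix c c' :: "int \<times> (int^'n) \<Rightarrow> complex" and \<alpha> \<beta> :: complex
    assume c: "c \<in> lp_space p" "c' \<in> lp_space p"
    show "AE x in lebesgue. synthesis p a b \<psi> (\<lambda>i. \<alpha> * c i + \<beta> * c' i) x
        = \<alpha> * synthesis p a b \<psi> c x + \<beta> * synthesis p a b \<psi> c' x"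
      using AE_summable_synthesis[OF prems c(1)] AE_summable_synthesis[OF prems c(2)]
      by eventually_elim (rule synthesis_lincomb)
  next
    fix c :: "int \<times> (int^'n) \<Rightarrow> complex" and \<epsilon> :: real
    assume c: "c \<in> lp_space p" and \<epsilon>: "\<epsilon> > 0"
    let ?K = "Lp_norm p \<psi> powr p"
    have K: "?K + 1 > 0"
      by (simp add: add_nonneg_pos)
    show "\<exists>\<delta>>0. \<forall>c'\<in>lp_space p.
        lp_dist p c c' < \<delta> \<longrightarrow> Lp_dist p (synthesis p a b \<psi> c) (synthesis p a b \<psi> c') < \<epsilon>"
    proof (intro exI conjI ballI impI)
      \<comment> \<open>The Lipschitz constant is \<open>?K\<close>; adding 1 keeps the denominator
        positive when \<open>\<psi>\<close> vanishes almost everywhere.\<close>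
      show "\<epsilon> / (?K + 1) > 0"
        using \<epsilon> K by simp
      fix c' assume c': "c' \<in> lp_space p" and "lp_dist p c c' < \<epsilon> / (?K + 1)"
      then have "(?K + 1) * lp_dist p c c' < \<epsilon>"
        using K by (simp add: field_simps)
      moreover have "?K * lp_dist p c c' \<le> (?K + 1) * lp_dist p c c'"
        by (intro mult_right_mono) (auto simp: lp_dist_def)
      ultimately show "Lp_dist p (synthesis p a b \<psi> c) (synthesis p a b \<psi> c') < \<epsilon>"
        using Lp_dist_synthesis_le[OF prems c c', of b] by linarith
    qed
  qed
qed

end
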